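(* For all integers $n,k$ with $n\ge k\ge 1$ and $n-k\ge 1$, the binomial Ward-Lah numbers $B(n,k)$ satisfy $$B(n,k)=2n(2n-1)\left(\frac{1}{n-k}\,B(n-1,k)+\frac{1}{k}\,B(n-1,k-1)\right).$$
   Context: Partition transformation: for integers $n,k\ge 0$ and a sequence $a_1,a_2,\dots$, $$P_n^k(a_1,a_2,\dots)=\sum_{q}(-1)^{q_0}\prod_{j=0}^{\ell(q)-1}\binom{q_j}{q_{j+1}}a_{j+1}^{q_j},$$ where the sum is over integer partitions $q=(q_0\ge q_1\ge\dots)$ of $n=q_0+q_1+\cdots$ with $q_0=k$; $\ell(q)$ is the length of $q$ (number of positive parts), so $q_{\ell(q)-1}>0$ and $q_{\ell(q)}=0$. Binomial Ward-Lah numbers: for integers $n\ge k\ge 0$, $B(n,k)=(-1)^k \dfrac{(2n)!}{k!(n-k)!}\,P_n^k(1,1,\dots)$ (all $a_i=1$), with $B(0,0)=1$, $B(n,0)=0$ for $n\ge 1$, $B(0,k)=0$ for $k\ge 1$, and $B(n,k)=0$ for $k>n$. *)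

theory Defs
  imports Complex_Main "HOL-Library.More_List"
begin

text \<open>An integer partition is the list of its positive parts in weakly decreasing order, so that
  its length is the number of parts. It is read as an infinite sequence by padding with zeros;
  in particular the part with index 0 of the empty partition is 0.\<close>

definition is_partition :: "nat list \<Rightarrow> nat \<Rightarrow> bool" where
  "is_partition q n \<longleftrightarrow> sorted_wrt (\<ge>) q \<and> (\<forall>x \<in> set q. 0 < x) \<and> sum_list q = n"

definition part :: "nat list \<Rightarrow> nat \<Rightarrow> nat" where
  "part q j = nth_default 0 q j"

text \<open>The sequence is indexed from 1; the value \<open>a 0\<close> is never used.\<close>

definition partition_transform :: "nat \<Rightarrow> nat \<Rightarrow> (nat \<Rightarrow> 'a::comm_ring_1) \<Rightarrow> 'a" where
  "partition_transform n k a =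
     (\<Sum>q \<in> {q. is_partition q n \<and> part q 0 = k}.
        (-1) ^ part q 0 *
        (\<Prod>j<length q. of_nat (part q j choose part q (j + 1)) * a (j + 1) ^ part q j))"

definition binomial_ward_lah :: "nat \<Rightarrow> nat \<Rightarrow> rat" where
  "binomial_ward_lah n k =
     (if k \<le> n
      then (-1) ^ k * (fact (2 * n) / (fact k * fact (n - k))) * partition_transform n k (\<lambda>_. 1)
      else 0)"

text \<open>The index set is finite, so the sum above is a genuine one.\<close>

lemma finite_partitions: "finite {q. is_partition q n \<and> part q 0 = k}"
proof (rule finite_subset)
  have len: "length q \<le> sum_list q" if "\<forall>x \<in> set q. 0 < x" for q :: "nat list"
    using that by (induction q) auto
  show "{q. is_partition q n \<and> part q 0 = k} \<subseteq> {q. set q \<subseteq> {..n} \<and> length q \<le> n}"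
    using len by (auto simp: is_partition_def intro: member_le_sum_list)
  show "finite {q. set q \<subseteq> {..n} \<and> length q \<le> n}"
    by (rule finite_lists_length_le) simp
qed

text \<open>The boundary conventions are consequences of the definition.\<close>

lemma partitions_part_0: "{q. is_partition q n \<and> part q 0 = 0} = (if n = 0 then {[]} else {})"
proof -
  have "is_partition q n \<and> part q 0 = 0 \<longleftrightarrow> q = [] \<and> n = 0" for q
    by (cases q) (auto simp: is_partition_def part_def)
  then show ?thesis by auto
qed

lemma binomial_ward_lah_boundary:
  "binomial_ward_lah 0 0 = 1"
  "1 \<le> n \<Longrightarrow> binomial_ward_lah n 0 = 0"
  "n < k \<Longrightarrow> binomial_ward_lah n k = 0"
  by (auto simp: binomial_ward_lah_def partition_transform_def partitions_part_0)
    (simp add: part_def)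

end

theory Submission
  imports Defs
begin

text \<open>A partition q with first part k whose weight is the product of the binomials
  (q_j choose q_{j+1}) encodes the compositions of n into k positive parts, q_j being the number
  of parts greater than j. Hence these weights sum to (n-1 choose k-1), and the recurrence is
  Pascal's rule. The sum is evaluated by removing the first part, which turns
  the induction step into Vandermonde's identity.\<close>

definition partition_weight :: "nat list \<Rightarrow> nat" where
  "partition_weight q = (\<Prod>j<length q. part q j choose part q (j + 1))"

lemma partition_weight_Nil [simp]: "partition_weight [] = 1"
  by (simp add: partition_weight_def)

lemma partition_weight_Cons [simp]:
  "partition_weight (k # q) = (k choose part q 0) * partition_weight q"
  by (simp add: partition_weight_def part_def prod.lessThan_Suc_shift del: prod.lessThan_Suc)

lemma is_partition_Cons_iff:
  "is_partition (k # q) n \<longleftrightarrow> 0 < k \<and> k \<le> n \<and> part q 0 \<le> k \<and> is_partition q (n - k)"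
  by (cases q) (auto simp: is_partition_def part_def)

lemma part_0_le: "is_partition q n \<Longrightarrow> part q 0 \<le> n"
  by (cases q) (auto simp: is_partition_def part_def)

lemma finite_is_partition: "finite {q. is_partition q n}"
proof -
  have "{q. is_partition q n} = (\<Union>k\<le>n. {q. is_partition q n \<and> part q 0 = k})"
    using part_0_le by auto
  then show ?thesis
    by (simp add: finite_partitions)
qed

lemma sum_partition_weight_rec:
  assumes "0 < k" "k \<le> n"
  shows "(\<Sum>q | is_partition q n \<and> part q 0 = k. partition_weight q) =
    (\<Sum>j\<le>n - k. (k choose j) * (\<Sum>q | is_partition q (n - k) \<and> part q 0 = j. partition_weight q))"
proof -
  let ?A = "{q. is_partition q (n - k)}"
  have "{q. is_partition q n \<and> part q 0 = k} = (#) k ` {q \<in> ?A. part q 0 \<le> k}"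
  proof (intro set_eqI)
    fix q
    show "q \<in> {q. is_partition q n \<and> part q 0 = k} \<longleftrightarrow> q \<in> (#) k ` {q \<in> ?A. part q 0 \<le> k}"
      using assms by (cases q) (auto simp: is_partition_Cons_iff part_def)
  qed
  then have "(\<Sum>q | is_partition q n \<and> part q 0 = k. partition_weight q) =
      (\<Sum>q\<in>{q \<in> ?A. part q 0 \<le> k}. (k choose part q 0) * partition_weight q)"
    by (simp add: sum.reindex)
  also have "\<dots> = (\<Sum>q\<in>?A. (k choose part q 0) * partition_weight q)"
    by (intro sum.mono_neutral_left) (auto simp: finite_is_partition)
  also have "\<dots> = (\<Sum>j\<le>n - k. \<Sum>q | q \<in> ?A \<and> part q 0 = j. (k choose part q 0) * partition_weight q)"
    by (intro sum.group [symmetric]) (auto simp: finite_is_partition part_0_le)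
  finally show ?thesis
    by (simp add: sum_distrib_left)
qed

text \<open>The lower index n - k, rather than k - 1, makes the formula hold for k = 0 as well.\<close>

lemma sum_partition_weight:
  "k \<le> n \<Longrightarrow>
    (\<Sum>q | is_partition q n \<and> part q 0 = k. partition_weight q) = (n - 1) choose (n - k)"
proof (induction n arbitrary: k rule: less_induct)
  case (less n)
  show ?case
  proof (cases "k = 0")
    case True
    \<comment> \<open>For \<open>n = 0\<close> the empty partition matches
      \<open>0 choose 0 = 1\<close>; for \<open>n > 0\<close> there is no partition and
      \<open>(n - 1) choose n = 0\<close>.\<close>
    then show ?thesis
      by (simp add: partitions_part_0)
  next
    case False
    have "(\<Sum>q | is_partition q n \<and> part q 0 = k. partition_weight q) =
        (\<Sum>j\<le>n - k. (k choose j) * ((n - k - 1) choose (n - k - j)))"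
      \<comment> \<open>Since \<open>k > 0\<close>, the induction hypothesis applies at
        \<open>n - k\<close> to every \<open>j\<close>, including \<open>j = 0\<close>.\<close>
      using False less by (simp add: sum_partition_weight_rec)
    also have "\<dots> = (k + (n - k - 1)) choose (n - k)"
      by (rule vandermonde)
    \<comment> \<open>If \<open>n = k\<close>, truncated subtraction makes the upper index
      \<open>k\<close> instead of \<open>n - 1\<close>, but both binomials have lower index
      0.\<close>
    also have "\<dots> = (n - 1) choose (n - k)"
      using less.prems by (cases "n = k") auto
    finally show ?thesis .
  qed
qed

text \<open>Every partition in the transform carries the sign \<open>(-1) ^ k\<close>, which cancels
  the sign in front.\<close>

lemma binomial_ward_lah_eq:
  assumes "k \<le> n"
  shows "binomial_ward_lah n k =
    fact (2 * n) / (fact k * fact (n - k)) * of_nat ((n - 1) choose (n - k))"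
proof -
  have "partition_transform n k (\<lambda>_. 1 :: rat) =
      (-1) ^ k * of_nat (\<Sum>q | is_partition q n \<and> part q 0 = k. partition_weight q)"
    by (simp add: partition_transform_def partition_weight_def sum_distrib_left)
  then show ?thesis
    using assms by (simp add: binomial_ward_lah_def sum_partition_weight flip: power_mult_distrib)
qed

theorem theorem6p5:
  fixes n k :: nat
  assumes "1 \<le> k" and "k \<le> n" and "1 \<le> n - k"
  shows "binomial_ward_lah n k =
    2 * of_nat n * (2 * of_nat n - 1) *
      (1 / (of_nat n - of_nat k) * binomial_ward_lah (n - 1) k
        + 1 / of_nat k * binomial_ward_lah (n - 1) (k - 1))"
proof -
  obtain i where k: "k = Suc i"
    using assms by (cases k) auto
  \<comment> \<open>Now \<open>n - k = Suc d\<close>, so no subtraction below is truncated.\<close>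
  obtain d where n: "n = Suc (Suc (i + d))"
    using assms k that [of "n - k - 1"] by auto
  define c :: rat where "c = fact (2 * (n - 1)) / (fact k * fact (n - k))"
  have fact_2n: "fact (2 * n) = (2 * of_nat n * (2 * of_nat n - 1) * fact (2 * (n - 1)) :: rat)"
    by (simp add: n algebra_simps)
  \<comment> \<open>The summands are the binomials of the closed form at \<open>(n - 1, k)\<close>
    and \<open>(n - 1, k - 1)\<close>.\<close>
  have pascal: "(n - 1) choose (n - k) = ((n - 2) choose (n - 1 - k)) + ((n - 2) choose (n - k))"
    by (simp add: n k)
  have "binomial_ward_lah n k = 2 * of_nat n * (2 * of_nat n - 1) *
      (c * of_nat ((n - 2) choose (n - 1 - k)) + c * of_nat ((n - 2) choose (n - k)))"
    unfolding binomial_ward_lah_eq [OF assms(2)] fact_2n pascal c_def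
    by (simp add: distrib_left)
  \<comment> \<open>The denominator of \<open>c\<close> yields the coefficients: a factor
    \<open>n - k\<close> split off \<open>fact (n - k)\<close> here, a factor \<open>k\<close> split
    off \<open>fact k\<close> in the next step.\<close>
  also have "c * of_nat ((n - 2) choose (n - 1 - k)) =
      1 / (of_nat n - of_nat k) * binomial_ward_lah (n - 1) k"
    by (simp add: binomial_ward_lah_eq c_def n k del: of_nat_Suc mult_Suc_right)
  also have "c * of_nat ((n - 2) choose (n - k)) =
      1 / of_nat k * binomial_ward_lah (n - 1) (k - 1)"
    by (simp add: binomial_ward_lah_eq c_def n k del: of_nat_Suc mult_Suc_right)
  finally show ?thesis .
qed

end
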